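(* Let $m>1$ be an integer, let $a\in[1,m-1]$ be an integer and let $A$ be an $m$-extension with ${\rm Kunz}^p(A)=(k_1,\dots,k_{m-1})$. Suppose $k_\ell\in\{2,3\}$ for all $\ell\in[1,a-1]$, $k_a=3$, and $k_\ell\in\{1,2\}$ for all $\ell\in[a+1,m-1]$. Then $A$ is a gapset, and $A$ has depth $3$.
   Context: $\mathbb N$ is the set of positive integers, $\mathbb N_0=\mathbb N\cup\{0\}$, $[a,b]=\{x\in\mathbb Z: a\le x\le b\}$. For an integer $m>1$, an $m$-extension is a finite set $A\subset\mathbb N$ containing $[1,m-1]$ that admits a partition $A=A_0\cup\dots\cup A_t$ for some $t\in\mathbb N_0$, with $A_0=[1,m-1]$ and $A_{i+1}\subseteq m+A_i$ for all $i$. Its pseudo Kunz coordinates: for $i\in[1,m-1]$ let $w_i=m+\max\{a\in A: a\equiv i\pmod m\}$, write $w_i=mk_i+i$, and ${\rm Kunz}^p(A)=(k_1,\dots,k_{m-1})$. A gapset is a finite set $G\subset\mathbb N$ such that whenever $z\in G$ and $z=x+y$ with $x,y\in\mathbb N$, then $x\in G$ or $y\in G$. Its multiplicity is $m(G)=\min\{s\in\mathbb N_0\setminus G: s\ne0\}$, its conductor is $c(G)=\min\{s\in\mathbb N_0: s+n\notin G\ \forall n\in\mathbb N_0\}$, and its depth is $\lceil c(G)/m(G)\rceil$. *)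

theory Defs
  imports Complex_Main "HOL-Library.Disjoint_Sets" "HOL-Number_Theory.Cong"
begin

definition m_extension :: "nat \<Rightarrow> nat set \<Rightarrow> bool" where
  "m_extension m A \<longleftrightarrow>
     finite A \<and> 0 \<notin> A \<and> {1..m - 1} \<subseteq> A \<and>
     (\<exists>t. \<exists>B :: nat \<Rightarrow> nat set.
        A = (\<Union>i\<le>t. B i) \<and> disjoint_family_on B {..t} \<and> (\<forall>i\<le>t. B i \<noteq> {}) \<and>
        B 0 = {1..m - 1} \<and> (\<forall>i<t. B (Suc i) \<subseteq> (\<lambda>x. m + x) ` B i))"

definition pseudo_apery :: "nat \<Rightarrow> nat set \<Rightarrow> nat \<Rightarrow> nat" where
  "pseudo_apery m A i = m + Max {a \<in> A. [a = i] (mod m)}"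

(* The tuple (k_1, ..., k_{m-1}) is a list of length m - 1, so k_i has list index i - 1.
   For an m-extension A with m > 1, the description determines exactly one k. *)
definition pseudo_Kunz :: "nat \<Rightarrow> nat set \<Rightarrow> nat list" where
  "pseudo_Kunz m A = map (\<lambda>i. THE k. pseudo_apery m A i = m * k + i) [1..<m]"

definition gapset :: "nat set \<Rightarrow> bool" where
  "gapset G \<longleftrightarrow>
     finite G \<and> 0 \<notin> G \<and>
     (\<forall>z\<in>G. \<forall>x y. x \<ge> 1 \<and> y \<ge> 1 \<and> z = x + y \<longrightarrow> x \<in> G \<or> y \<in> G)"

definition multiplicity_of :: "nat set \<Rightarrow> nat" where
  "multiplicity_of G = (LEAST s. s \<notin> G \<and> s \<noteq> 0)"

definition conductor :: "nat set \<Rightarrow> nat" where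
  "conductor G = (LEAST s. \<forall>n. s + n \<notin> G)"

definition depth :: "nat set \<Rightarrow> int" where
  "depth G = \<lceil>real (conductor G) / real (multiplicity_of G)\<rceil>"

end

theory Submission
  imports Defs
begin

text \<open>The pseudo Kunz coordinates describe an \<open>m\<close>-extension completely: \<open>x \<in> A\<close> iff
  \<open>m\<close> does not divide \<open>x\<close> and \<open>x div m < k (x mod m)\<close>. If \<open>x, y \<notin> A\<close> had residues \<open>r, s\<close>
  and \<open>x + y \<in> A\<close>, then either \<open>r + s > m\<close> and \<open>k r + k s + 1 < 3\<close>, which is absurd, or
  \<open>r + s < m\<close> and \<open>k r + k s < k (r + s) \<le> 3\<close>. The latter forces \<open>k r = k s = 1\<close>, so
  \<open>r, s > a\<close>, whence \<open>k (r + s) \<le> 2\<close>, again absurd. The largest element of \<open>A\<close> is \<open>2m + a\<close>.\<close>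

text \<open>The layer \<open>B 0\<close> contains no multiple of \<open>m\<close>, and each later
  layer arises by translation by \<open>m\<close>, which preserves residues.\<close>

lemma m_extension_mod_neq_0:
  assumes "m > 1" "m_extension m A" "x \<in> A"
  shows "x mod m \<noteq> 0"
proof -
  obtain t B where A: "A = (\<Union>i\<le>t. B i)" and B0: "B 0 = {1..m - 1}"
    and step: "\<forall>i<t. B (Suc i) \<subseteq> (\<lambda>x. m + x) ` B i"
    using assms(2) unfolding m_extension_def by auto
  have "\<forall>x\<in>B i. x mod m \<noteq> 0" if "i \<le> t" for i
    using that
  proof (induction i)
    case 0
    then show ?case using B0 assms(1) by auto
  next
    case (Suc i)
    then have "B (Suc i) \<subseteq> (\<lambda>x. m + x) ` B i" using step by simp
    then show ?case using Suc by fastforce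
  qed
  then show ?thesis using A assms(3) by auto
qed

text \<open>The layer \<open>B 0\<close> lies below \<open>m\<close>, so \<open>x + m\<close> sits
  in a later layer and is a translate of an element of the layer before it.\<close>

lemma m_extension_diff:
  assumes "m > 1" "m_extension m A" "x + m \<in> A" "x > 0"
  shows "x \<in> A"
proof -
  obtain t B where A: "A = (\<Union>i\<le>t. B i)" and B0: "B 0 = {1..m - 1}"
    and step: "\<forall>i<t. B (Suc i) \<subseteq> (\<lambda>x. m + x) ` B i"
    using assms(2) unfolding m_extension_def by auto
  obtain i where i: "i \<le> t" "x + m \<in> B i" using A assms(3) by auto
  then obtain j where j: "i = Suc j" using B0 assms(1) by (cases i) auto
  then have "B i \<subseteq> (\<lambda>x. m + x) ` B j" using step i by simp
  then have "x + m \<in> (\<lambda>x. m + x) ` B j" using i by blast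
  then have "x \<in> B j" by auto
  then show ?thesis using A i j by auto
qed

lemma m_extension_down:
  assumes "m > 1" "m_extension m A" "i + m * q \<in> A" "i > 0" "p \<le> q"
  shows "i + m * p \<in> A"
  using assms(5,3)
proof (induction rule: inc_induct)
  case (step n)
  have "(i + m * n) + m \<in> A" using step by (simp add: algebra_simps)
  then show ?case using m_extension_diff[OF assms(1,2)] assms(4) by simp
qed

text \<open>Closure under subtracting \<open>m\<close> makes each nonzero residue class of
  \<open>A\<close> an unbroken run starting at its residue, so its maximum determines it.\<close>

lemma m_extension_iff_pseudo_Kunz:
  assumes m: "m > 1" and ext: "m_extension m A" and K: "pseudo_Kunz m A = map k [1..<m]"
  shows "x \<in> A \<longleftrightarrow> x mod m \<noteq> 0 \<and> x div m < k (x mod m)"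
proof (cases "x mod m = 0")
  case True
  then show ?thesis using m_extension_mod_neq_0[OF m ext] by metis
next
  case False
  define i where "i = x mod m"
  define S where "S = {a \<in> A. [a = i] (mod m)}"
  have i: "0 < i" "i < m" using False m by (auto simp: i_def)
  have "finite A" "{1..m - 1} \<subseteq> A" using ext by (auto simp: m_extension_def)
  \<comment> \<open>The class contains \<open>i\<close> itself, so \<open>Max S\<close> is attained
    and not an unspecified value.\<close>
  then have S: "finite S" "i \<in> S" using i by (auto simp: S_def)
  then have MS: "Max S \<in> S" by (metis Max_in empty_iff)
  then have Mmod: "Max S mod m = i" using i by (simp add: S_def cong_def)
  define q where "q = Max S div m"
  have Mq: "Max S = i + m * q" using Mmod unfolding q_def by (metis mod_mult_div_eq)
  \<comment> \<open>The extra \<open>m\<close> in \<open>pseudo_apery\<close> makes the coordinate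
    one more than the quotient of the maximum; hence the strict inequality in the criterion.\<close>
  have ap: "pseudo_apery m A i = m * Suc q + i"
    using Mq by (simp add: pseudo_apery_def S_def)
  have "(THE k. pseudo_apery m A i = m * k + i) = k i"
    using K i unfolding pseudo_Kunz_def by simp
  moreover have "(THE k. pseudo_apery m A i = m * k + i) = Suc q"
    using ap m by (intro the_equality) (auto simp del: mult_Suc_right)
  ultimately have ki: "k i = Suc q" by simp
  have x: "x = i + m * (x div m)" by (simp add: i_def)
  have "x \<in> A \<longleftrightarrow> x div m \<le> q"
  proof
    assume "x \<in> A"
    then have "x \<in> S" by (simp add: S_def i_def cong_def)
    then have "x \<le> Max S" using S by simp
    then show "x div m \<le> q" unfolding q_def by (rule div_le_mono)
  next
    assume "x div m \<le> q"
    moreover have "i + m * q \<in> A" using MS Mq by (simp add: S_def)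
    ultimately show "x \<in> A" using m_extension_down[OF m ext] i(1) x by metis
  qed
  then show ?thesis using ki False by (simp add: i_def less_Suc_eq_le)
qed

lemma multiplicity_of_m_extension:
  assumes "m > 1" "m_extension m A"
  shows "multiplicity_of A = m"
  unfolding multiplicity_of_def
proof (rule Least_equality)
  show "m \<notin> A \<and> m \<noteq> 0" using m_extension_mod_neq_0[OF assms, of m] assms(1) by auto
next
  fix s assume s: "s \<notin> A \<and> s \<noteq> 0"
  have "{1..m - 1} \<subseteq> A" using assms(2) by (simp add: m_extension_def)
  then have "s \<notin> {1..m - 1}" using s by blast
  then show "m \<le> s" using s by auto
qed

lemma conductor_eq_Suc_greatest:
  assumes "g \<in> A" "\<And>x. x \<in> A \<Longrightarrow> x \<le> g"
  shows "conductor A = Suc g"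
  unfolding conductor_def
proof (rule Least_equality)
  show "\<forall>n. Suc g + n \<notin> A" using assms(2) by force
next
  fix s assume "\<forall>n. s + n \<notin> A"
  then have "\<not> s \<le> g" using assms(1) by (metis le_add_diff_inverse)
  then show "Suc g \<le> s" by simp
qed

theorem theorem5p1:
  fixes m a :: nat and A :: "nat set" and k :: "nat \<Rightarrow> nat"
  assumes "m > 1"
    and "a \<in> {1..m - 1}"
    and "m_extension m A"
    and "pseudo_Kunz m A = map k [1..<m]"
    and "\<forall>l\<in>{1..a - 1}. k l \<in> {2, 3}"
    and "k a = 3"
    and "\<forall>l\<in>{a + 1..m - 1}. k l \<in> {1, 2}"
  shows "gapset A \<and> depth A = 3"
proof
  note mem = m_extension_iff_pseudo_Kunz[OF assms(1,3,4)]
  have a: "0 < a" "a < m" using assms(1,2) by auto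
  have k_low: "k l \<in> {2, 3}" if "0 < l" "l < a" for l
    using assms(5) that by simp
  have k_high: "k l \<in> {1, 2}" if "a < l" "l < m" for l
    using assms(7) that by simp
  have k_ge: "1 \<le> k l" and k_le: "k l \<le> 3" if "0 < l" "l < m" for l
    using that k_low[of l] k_high[of l] assms(6) by (cases l a rule: linorder_cases; auto)+
  have k_one: "a < l" if "k l = 1" "0 < l" for l
    using that k_low[of l] assms(6) by (cases l a rule: linorder_cases) auto
  show "gapset A"
    unfolding gapset_def
  proof (intro conjI ballI allI impI)
    show "finite A" "0 \<notin> A" using assms(3) by (auto simp: m_extension_def)
    fix z x y assume z: "z \<in> A" and "1 \<le> x \<and> 1 \<le> y \<and> z = x + y"
    then have zxy: "z = x + y" by simp
    show "x \<in> A \<or> y \<in> A"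
    proof (rule ccontr)
      assume "\<not> (x \<in> A \<or> y \<in> A)"
      then have nx: "x \<notin> A" and ny: "y \<notin> A" by auto
      define r s p q where "r = x mod m" "s = y mod m" "p = x div m" "q = y div m"
      note defs = this
      have rs: "r < m" "s < m" using assms(1) by (auto simp: defs)
      have zmod: "z mod m = (r + s) mod m" by (simp add: zxy defs mod_add_eq)
      \<comment> \<open>The last summand is the carry from adding the residues.\<close>
      have zdiv: "z div m = p + q + (r + s) div m" unfolding zxy defs by (rule div_add1_eq)
      have zA: "(r + s) mod m \<noteq> 0" "p + q + (r + s) div m < k ((r + s) mod m)"
        using z mem[of z] zmod zdiv by auto
      \<comment> \<open>If \<open>m\<close> divided \<open>x\<close>, then \<open>z\<close> would
        share the residue of \<open>y\<close> with a quotient at least as large, so \<open>z\<close>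
        in \<open>A\<close> would put \<open>y\<close> in \<open>A\<close>.\<close>
      have r0: "r \<noteq> 0"
      proof
        assume "r = 0"
        then show False using zA ny mem[of y] rs by (auto simp flip: defs)
      qed
      have s0: "s \<noteq> 0"
      proof
        assume "s = 0"
        then show False using zA nx mem[of x] rs by (auto simp flip: defs)
      qed
      have pq: "k r \<le> p" "k s \<le> q"
        using nx ny mem[of x] mem[of y] r0 s0 by (auto simp flip: defs)
      have kr: "1 \<le> k r" and ks: "1 \<le> k s" using k_ge r0 s0 rs by auto
      have le3: "k ((r + s) mod m) \<le> 3" using k_le zA(1) assms(1) by simp
      show False
      proof (cases "r + s < m")
        case True
        then have lt: "p + q < k (r + s)" and "k (r + s) \<le> 3" using zA le3 by auto
        then have "k r = 1" "k s = 1" using pq kr ks by auto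
        then have "a < r" using k_one r0 by simp
        then have "k (r + s) \<le> 2" using k_high[of "r + s"] True by auto
        then show False using lt pq kr ks by linarith
      next
        case False
        then have "1 \<le> (r + s) div m" using rs by (simp add: div_greater_zero_iff Suc_le_eq)
        then show False using zA(2) le3 pq kr ks by linarith
      qed
    qed
  qed
  have "conductor A = Suc (2 * m + a)"
  proof (rule conductor_eq_Suc_greatest)
    show "2 * m + a \<in> A" using mem[of "2 * m + a"] a assms(6) by simp
    fix x assume "x \<in> A"
    then have x: "x mod m \<noteq> 0" "x div m < k (x mod m)" using mem by auto
    have lt: "x mod m < m" using assms(1) by simp
    have eq: "x = m * (x div m) + x mod m" by simp
    \<comment> \<open>Quotient 2 is possible only for residues up to \<open>a\<close>; beyond
      \<open>a\<close> the quotient is at most 1, so \<open>x\<close> stays below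
      \<open>2 * m\<close>.\<close>
    show "x \<le> 2 * m + a"
    proof (cases "x mod m \<le> a")
      case True
      have "x div m \<le> 2" using x(2) k_le[of "x mod m"] x(1) lt by simp
      then have "m * (x div m) \<le> m * 2" by (rule mult_le_mono2)
      then show ?thesis using True eq by linarith
    next
      case False
      have "x div m \<le> 1" using x(2) k_high[of "x mod m"] False lt by auto
      then have "m * (x div m) \<le> m * 1" by (rule mult_le_mono2)
      then show ?thesis using lt eq by linarith
    qed
  qed
  then have "depth A = \<lceil>real (Suc (2 * m + a)) / real m\<rceil>"
    by (simp add: depth_def multiplicity_of_m_extension[OF assms(1,3)])
  \<comment> \<open>Since 1 \<le> \<open>a\<close> < \<open>m\<close>, the conductor lies strictly
    above \<open>2 * m\<close> and is at most \<open>3 * m\<close>.\<close>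
  also have "\<dots> = 3"
  proof (rule ceiling_unique)
    show "real_of_int 3 - 1 < real (Suc (2 * m + a)) / real m"
      using a by (simp add: field_simps)
    show "real (Suc (2 * m + a)) / real m \<le> real_of_int 3"
      using a by (simp add: field_simps)
  qed
  finally show "depth A = 3" .
qed

end
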